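(* Let $E=\begin{pmatrix}A& C\\ C^{\sf T}& B\end{pmatrix}$ be an extreme point of $\mathcal{E}_{n+m}$, where $A$ is $n\times n$, $B$ is $m\times m$, and $\mathrm{rank}(A)=\mathrm{rank}(E)=n$. Let $\Lambda=(\lambda_{ij})$ be a real $n\times m$ matrix with $C=A\Lambda$ and $B=\Lambda^{\sf T}A\Lambda$ (such a matrix exists). Let $X_1,\ldots,X_n$ be $d\times d$ Hermitian matrices satisfying $$X_i^2=I_d \text{ for all } i\in\{1,\ldots,n\},\qquad \Big(\sum_{i=1}^n\lambda_{ij}X_i\Big)^2=I_d \text{ for all } j\in\{1,\ldots,m\}.$$ Then $$\Big(\sum_{i=1}^n\mu_iX_i\Big)^2=(\mu^{\sf T}A\mu)\,I_d\quad\text{for all }\mu=(\mu_i)\in\mathbb{R}^n.$$ In particular, the complex algebra $\mathbb{C}[X_1,\ldots,X_n]$ generated by $X_1,\ldots,X_n$ is isomorphic to the rank-$n$ Clifford algebra $\mathcal{C}_n$, and consequently $d\ge 2^{\lfloor n/2\rfloor}$.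
   Context: $\mathcal{E}_{N}$ is the elliptope: the set of real symmetric positive semidefinite $N\times N$ matrices with all diagonal entries equal to $1$; an extreme point is a point not expressible as a proper convex combination of two distinct points of $\mathcal{E}_N$. The rank-$n$ Clifford algebra $\mathcal{C}_n$ is the universal $C^*$-algebra generated by Hermitian indeterminates $z_1,\ldots,z_n$ subject to $z_iz_j+z_jz_i=2\delta_{ij}I$ for all $i,j$. *)

theory Defs
  imports "HOL-Analysis.Analysis"
begin

definition psd_mat :: "real^'k^'k \<Rightarrow> bool" where
  "psd_mat M \<longleftrightarrow> transpose M = M \<and> (\<forall>x. 0 \<le> x \<bullet> (M *v x))"

definition elliptope :: "(real^'k^'k) set" where
  "elliptope = {M. psd_mat M \<and> (\<forall>i. M $ i $ i = 1)}"

definition cadjoint :: "complex^'d^'d \<Rightarrow> complex^'d^'d" where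
  "cadjoint M = (\<chi> i j. cnj (M $ j $ i))"

definition hermitian_cmat :: "complex^'d^'d \<Rightarrow> bool" where
  "hermitian_cmat M \<longleftrightarrow> cadjoint M = M"

definition blkA :: "real^('n::finite+'m::finite)^('n+'m) \<Rightarrow> real^'n^'n" where
  "blkA E = (\<chi> i j. E $ Inl i $ Inl j)"
definition blkB :: "real^('n::finite+'m::finite)^('n+'m) \<Rightarrow> real^'m^'m" where
  "blkB E = (\<chi> i j. E $ Inr i $ Inr j)"
definition blkC :: "real^('n::finite+'m::finite)^('n+'m) \<Rightarrow> real^'m^'n" where
  "blkC E = (\<chi> i j. E $ Inl i $ Inr j)"

end

(*
  With A the upper left block and w the family e_1, ..., e_n, Lambda e_1, ..., Lambda e_m,
  the matrix E is the Gram matrix (w_p . A w_q). Since rank A = n, A is positive definite,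
  so for a symmetric S with w_p . S w_p = 0 for all p, the Gram matrices of A + t S and
  A - t S lie in the elliptope for small t and have E as midpoint; extremality forces
  S = 0. Hence the rank-one matrices w_p w_p^T span all symmetric matrices. The map
  M |-> sum_ik M_ik X_i X_k - <A, M> I is linear and vanishes on every w_p w_p^T by
  hypothesis, so it vanishes on mu mu^T, which is the square identity.

  For the bound on d, pick an A-orthonormal basis: its images Y_1, ..., Y_n are pairwise
  anticommuting involutions. J = Y_1 Y_2 squares to -1, Y_1 swaps the eigenspaces of J
  for -i and i, and Y_3, ..., Y_n commute with J. So the -i eigenspace has at most half
  the dimension and carries n - 2 anticommuting involutions, and induction gives
  2 * 2^(n div 2) <= dim_R C^d = 2 d.
*)
theory Submission
  imports Defs
begin

section \<open>Quadratic forms\<close>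

lemma symmetric_bilinear_form:
  fixes A :: "real^'n^'n"
  assumes "transpose A = A"
  shows "b \<bullet> (A *v a) = a \<bullet> (A *v b)"
  by (metis assms dot_lmul_matrix inner_commute vector_transpose_matrix)

lemma nonneg_quadratic_imp_linear_coeff_zero:
  fixes a b :: real
  assumes "\<And>t. 0 \<le> b * t + a * t\<^sup>2"
  shows "b = 0"
proof (rule ccontr)
  assume "b \<noteq> 0"
  define c where "c = \<bar>a\<bar> + 1"
  have "c > 0" "a - c < 0"
    by (simp_all add: c_def)
  define t where "t = - b / c"
  have "b * t + a * t\<^sup>2 = b\<^sup>2 / c\<^sup>2 * (a - c)"
    using \<open>c > 0\<close> by (simp add: t_def field_simps power2_eq_square)
  also have "\<dots> < 0"
    using \<open>b \<noteq> 0\<close> \<open>c > 0\<close> \<open>a - c < 0\<close> by (intro mult_pos_neg) auto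
  finally show False
    using assms[of t] by linarith
qed

lemma psd_quadratic_form_zero_imp_kernel:
  fixes A :: "real^'n^'n"
  assumes psd: "psd_mat A" and "y \<bullet> (A *v y) = 0"
  shows "A *v y = 0"
proof -
  let ?z = "A *v y"
  have expand: "(y + t *\<^sub>R ?z) \<bullet> (A *v (y + t *\<^sub>R ?z)) = 2 * (?z \<bullet> ?z) * t + (?z \<bullet> (A *v ?z)) * t\<^sup>2"
    for t
    using assms symmetric_bilinear_form[of A ?z y] unfolding psd_mat_def
    by (simp add: matrix_vector_right_distrib matrix_vector_mult_scaleR inner_add_left inner_add_right
        power2_eq_square algebra_simps)
  have "2 * (?z \<bullet> ?z) = 0"
  proof (rule nonneg_quadratic_imp_linear_coeff_zero)
    show "0 \<le> 2 * (?z \<bullet> ?z) * t + (?z \<bullet> (A *v ?z)) * t\<^sup>2" for t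
      using psd expand[of t] unfolding psd_mat_def by metis
  qed
  then show ?thesis
    by simp
qed

lemma psd_full_rank_imp_pos_def:
  fixes A :: "real^'n^'n"
  assumes psd: "psd_mat A" and "rank A = CARD('n)" and "x \<noteq> 0"
  shows "0 < x \<bullet> (A *v x)"
proof -
  have "A *v x \<noteq> A *v 0"
    using assms(2,3) full_rank_injective[of A] by (metis injD)
  then have "x \<bullet> (A *v x) \<noteq> 0"
    using psd_quadratic_form_zero_imp_kernel[OF psd] by auto
  then show ?thesis
    using psd unfolding psd_mat_def by (metis order_le_less)
qed

lemma pos_def_coercive:
  fixes A :: "real^'n^'n"
  assumes pd: "\<And>x. x \<noteq> 0 \<Longrightarrow> 0 < x \<bullet> (A *v x)"
  obtains m where "m > 0" "\<And>y. m * (norm y)\<^sup>2 \<le> y \<bullet> (A *v y)"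
proof -
  have "continuous_on (sphere 0 1) (\<lambda>y::real^'n. y \<bullet> (A *v y))"
    by (intro continuous_intros linear_continuous_on matrix_vector_mul_linear)
  moreover have "sphere (0::real^'n) 1 \<noteq> {}"
    by simp
  ultimately obtain u where u: "u \<in> sphere 0 1"
    and min: "\<And>y. y \<in> sphere 0 1 \<Longrightarrow> u \<bullet> (A *v u) \<le> y \<bullet> (A *v y)"
    using continuous_attains_inf[OF compact_sphere] by blast
  define m where "m = u \<bullet> (A *v u)"
  have "u \<noteq> 0"
    using u by auto
  then have "m > 0"
    using pd by (simp add: m_def)
  moreover have "m * (norm y)\<^sup>2 \<le> y \<bullet> (A *v y)" for y
  proof (cases "y = 0")
    case False
    define v where "v = (1 / norm y) *\<^sub>R y"
    have y: "y = norm y *\<^sub>R v"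
      using False by (simp add: v_def)
    have "y \<bullet> (A *v y) = (norm y)\<^sup>2 * (v \<bullet> (A *v v))"
      by (subst (1 2) y) (simp add: matrix_vector_mult_scaleR power2_eq_square)
    moreover have "m \<le> v \<bullet> (A *v v)"
      using min[of v] False by (simp add: m_def v_def)
    ultimately show ?thesis
      by (metis mult.commute mult_right_mono zero_le_power2)
  qed simp
  ultimately show ?thesis
    using that by blast
qed

lemma quadratic_form_bounded:
  fixes S :: "real^'n^'n"
  obtains K where "K > 0" "\<And>y. \<bar>y \<bullet> (S *v y)\<bar> \<le> K * (norm y)\<^sup>2"
proof -
  obtain K where K: "K > 0" "\<And>y. norm (S *v y) \<le> norm y * K"
    using bounded_linear.pos_bounded[of "(*v) S"] by (auto simp: linear_conv_bounded_linear)
  have "\<bar>y \<bullet> (S *v y)\<bar> \<le> K * (norm y)\<^sup>2" for y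
  proof -
    have "\<bar>y \<bullet> (S *v y)\<bar> \<le> norm y * norm (S *v y)"
      by (rule Cauchy_Schwarz_ineq2)
    also have "\<dots> \<le> norm y * (norm y * K)"
      using K(2) by (simp add: mult_left_mono)
    finally show ?thesis
      by (simp add: power2_eq_square mult_ac)
  qed
  with K(1) that show ?thesis
    by blast
qed

lemma pos_def_perturbation_nonneg:
  fixes A S :: "real^'n^'n"
  assumes "\<And>x. x \<noteq> 0 \<Longrightarrow> 0 < x \<bullet> (A *v x)"
  obtains t where "t > 0" "\<And>s y. \<bar>s\<bar> \<le> t \<Longrightarrow> 0 \<le> y \<bullet> ((A + s *\<^sub>R S) *v y)"
proof -
  obtain m where m: "m > 0" "\<And>y. m * (norm y)\<^sup>2 \<le> y \<bullet> (A *v y)"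
    using pos_def_coercive assms by blast
  obtain K where K: "K > 0" "\<And>y. \<bar>y \<bullet> (S *v y)\<bar> \<le> K * (norm y)\<^sup>2"
    using quadratic_form_bounded by blast
  have "0 \<le> y \<bullet> ((A + s *\<^sub>R S) *v y)" if s: "\<bar>s\<bar> \<le> m / K" for s y
  proof -
    have "\<bar>s * (y \<bullet> (S *v y))\<bar> \<le> m / K * (K * (norm y)\<^sup>2)"
      unfolding abs_mult using s K(2)[of y] by (intro mult_mono) auto
    also have "\<dots> = m * (norm y)\<^sup>2"
      using K(1) by simp
    finally show ?thesis
      using m(2)[of y]
      by (simp add: matrix_vector_mult_add_rdistrib scaleR_matrix_vector_assoc[symmetric] inner_add_right)
  qed
  moreover have "m / K > 0"
    using m(1) K(1) by simp
  ultimately show ?thesis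
    using that by blast
qed

lemma subspace_dim_le_Suc_orthogonal:
  fixes A :: "real^'n^'n"
  assumes "subspace U" and "\<mu> \<in> U" and "\<mu> \<bullet> (A *v \<mu>) = 1"
  shows "dim U \<le> Suc (dim {\<nu> \<in> U. \<nu> \<bullet> (A *v \<mu>) = 0})"
proof -
  let ?U' = "{\<nu> \<in> U. \<nu> \<bullet> (A *v \<mu>) = 0}"
  have "U \<subseteq> span (insert \<mu> ?U')"
  proof
    fix \<nu> assume "\<nu> \<in> U"
    define c where "c = \<nu> \<bullet> (A *v \<mu>)"
    have "\<nu> - c *\<^sub>R \<mu> \<in> U"
      using assms(1,2) \<open>\<nu> \<in> U\<close> by (intro subspace_diff subspace_scale)
    moreover have "(\<nu> - c *\<^sub>R \<mu>) \<bullet> (A *v \<mu>) = 0"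
      using assms(3) by (simp add: inner_diff_left c_def)
    ultimately have "\<nu> - c *\<^sub>R \<mu> \<in> ?U'"
      by blast
    then have "(\<nu> - c *\<^sub>R \<mu>) + c *\<^sub>R \<mu> \<in> span (insert \<mu> ?U')"
      by (intro span_add span_scale span_base) auto
    then show "\<nu> \<in> span (insert \<mu> ?U')"
      by simp
  qed
  then have "dim U \<le> dim (span (insert \<mu> ?U'))"
    by (rule dim_subset)
  also have "\<dots> \<le> Suc (dim ?U')"
    by (simp add: dim_span dim_insert)
  finally show ?thesis .
qed

lemma pos_def_orthonormal_family:
  fixes A :: "real^'n^'n"
  assumes A_sym: "transpose A = A" and pd: "\<And>x. x \<noteq> 0 \<Longrightarrow> 0 < x \<bullet> (A *v x)"
    and "subspace U" and "k \<le> dim U"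
  shows "\<exists>e. (\<forall>i<k. e i \<in> U) \<and> (\<forall>i<k. \<forall>j<k. e i \<bullet> (A *v e j) = (if i = j then 1 else 0))"
  using assms(3,4)
proof (induction k arbitrary: U)
  case (Suc k)
  have "\<not> U \<subseteq> {0}"
    using Suc.prems(2) dim_eq_0[of U] by linarith
  then obtain x where x: "x \<in> U" "x \<noteq> 0"
    by blast
  define \<mu> where "\<mu> = (1 / sqrt (x \<bullet> (A *v x))) *\<^sub>R x"
  have "\<mu> \<in> U"
    using Suc.prems(1) x(1) by (simp add: \<mu>_def subspace_scale)
  have "\<mu> \<bullet> (A *v \<mu>) = (1 / sqrt (x \<bullet> (A *v x)))\<^sup>2 * (x \<bullet> (A *v x))"
    by (simp add: \<mu>_def matrix_vector_mult_scaleR power2_eq_square)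
  also have "\<dots> = 1"
    using pd[OF x(2)] by (simp add: power_divide)
  finally have \<mu>_unit: "\<mu> \<bullet> (A *v \<mu>) = 1" .
  let ?U' = "{\<nu> \<in> U. \<nu> \<bullet> (A *v \<mu>) = 0}"
  have "subspace ?U'"
    using Suc.prems(1) unfolding subspace_def by (auto simp: inner_add_left)
  moreover have "k \<le> dim ?U'"
    using subspace_dim_le_Suc_orthogonal[OF Suc.prems(1) \<open>\<mu> \<in> U\<close> \<mu>_unit] Suc.prems(2) by linarith
  ultimately obtain e where e: "\<forall>i<k. e i \<in> ?U'" "\<forall>i<k. \<forall>j<k. e i \<bullet> (A *v e j) = (if i = j then 1 else 0)"
    using Suc.IH by blast
  have perp: "e i \<bullet> (A *v \<mu>) = 0" "\<mu> \<bullet> (A *v e i) = 0" if "i < k" for i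
    using e(1) that symmetric_bilinear_form[OF A_sym, of \<mu> "e i"] by auto
  show ?case
  proof (intro exI[of _ "case_nat \<mu> e"] conjI allI impI)
    show "case_nat \<mu> e i \<in> U" if "i < Suc k" for i
      using that e(1) \<open>\<mu> \<in> U\<close> by (cases i) auto
    show "case_nat \<mu> e i \<bullet> (A *v case_nat \<mu> e j) = (if i = j then 1 else 0)"
      if "i < Suc k" "j < Suc k" for i j
      using that e(2) perp \<mu>_unit by (cases i; cases j) simp_all
  qed
qed simp

section \<open>Gram matrices and extreme points of the elliptope\<close>

definition gram :: "real^'n^'n \<Rightarrow> ('k \<Rightarrow> real^'n) \<Rightarrow> real^'k^'k" where
  "gram G w = (\<chi> p q. w p \<bullet> (G *v w q))"

lemma gram_add_scaleR: "gram (G + s *\<^sub>R H) w = gram G w + s *\<^sub>R gram H w"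
  by (simp add: gram_def vec_eq_iff matrix_vector_mult_add_rdistrib
      scaleR_matrix_vector_assoc[symmetric] inner_add_right)

lemma quadratic_form_gram:
  fixes G :: "real^'n^'n" and w :: "'k::finite \<Rightarrow> real^'n"
  shows "x \<bullet> (gram G w *v x) = (\<Sum>p\<in>UNIV. x $ p *\<^sub>R w p) \<bullet> (G *v (\<Sum>p\<in>UNIV. x $ p *\<^sub>R w p))"
proof -
  have "(\<Sum>p\<in>UNIV. x $ p *\<^sub>R w p) \<bullet> (G *v (\<Sum>q\<in>UNIV. x $ q *\<^sub>R w q))
      = (\<Sum>q\<in>UNIV. \<Sum>p\<in>UNIV. x $ q * (x $ p * (w p \<bullet> (G *v w q))))"
    by (simp add: vec.sum matrix_vector_mult_scaleR inner_sum_left inner_sum_right sum_distrib_left)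
  also have "\<dots> = (\<Sum>p\<in>UNIV. \<Sum>q\<in>UNIV. x $ q * (x $ p * (w p \<bullet> (G *v w q))))"
    by (rule sum.swap)
  also have "\<dots> = x \<bullet> (gram G w *v x)"
    by (simp add: gram_def inner_vec_def matrix_vector_mult_def sum_distrib_left mult_ac)
  finally show ?thesis
    by simp
qed

lemma psd_mat_gram:
  fixes G :: "real^'n^'n" and w :: "'k::finite \<Rightarrow> real^'n"
  assumes "transpose G = G" and "\<And>y. 0 \<le> y \<bullet> (G *v y)"
  shows "psd_mat (gram G w)"
  unfolding psd_mat_def quadratic_form_gram
  using assms symmetric_bilinear_form[OF assms(1)]
  by (simp add: gram_def transpose_def vec_eq_iff)

lemma extreme_gram_trivial_perturbation:
  fixes A S :: "real^'n^'n" and w :: "'k::finite \<Rightarrow> real^'n"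
  assumes ext: "gram A w extreme_point_of elliptope"
    and A_sym: "transpose A = A" and S_sym: "transpose S = S"
    and pd: "\<And>x. x \<noteq> 0 \<Longrightarrow> 0 < x \<bullet> (A *v x)"
    and diag: "\<And>p. w p \<bullet> (S *v w p) = 0"
  shows "gram S w = 0"
proof -
  obtain t where t: "t > 0" "\<And>s y. \<bar>s\<bar> \<le> t \<Longrightarrow> 0 \<le> y \<bullet> ((A + s *\<^sub>R S) *v y)"
    using pos_def_perturbation_nonneg[OF pd] by blast
  have "gram A w \<in> elliptope"
    using ext by (simp add: extreme_point_of_def)
  then have unit_diag: "gram A w $ p $ p = 1" for p
    by (simp add: elliptope_def)
  have in_elliptope: "gram (A + s *\<^sub>R S) w \<in> elliptope" if "\<bar>s\<bar> \<le> t" for s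
  proof -
    have "transpose (A + s *\<^sub>R S) = A + s *\<^sub>R S"
      using A_sym S_sym by (simp add: transpose_def vec_eq_iff)
    then have "psd_mat (gram (A + s *\<^sub>R S) w)"
      using t(2)[OF that] by (intro psd_mat_gram)
    moreover have "gram (A + s *\<^sub>R S) w $ p $ p = 1" for p
      using unit_diag[of p] diag[of p]
      by (simp add: gram_def matrix_vector_mult_add_rdistrib scaleR_matrix_vector_assoc[symmetric]
          inner_add_right)
    ultimately show ?thesis
      by (simp add: elliptope_def)
  qed
  let ?P = "gram (A + t *\<^sub>R S) w" and ?N = "gram (A + (- t) *\<^sub>R S) w"
  have P: "?P = gram A w + t *\<^sub>R gram S w"
    by (rule gram_add_scaleR)
  have N: "?N = gram A w - t *\<^sub>R gram S w"
    using gram_add_scaleR[of A "- t" S w] by simp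
  have "gram A w = midpoint ?P ?N"
    unfolding P N by (simp add: midpoint_def algebra_simps)
  moreover have "?P \<in> elliptope" "?N \<in> elliptope"
    by (rule in_elliptope, use t(1) in simp)+
  ultimately have "?P = ?N"
    using ext unfolding extreme_point_of_def by (metis midpoint_in_open_segment)
  then show ?thesis
    using t(1) unfolding P N by (simp add: vec_eq_iff)
qed

definition outer :: "real^'n \<Rightarrow> real^'n^'n" where
  "outer v = (\<chi> i k. v $ i * v $ k)"

lemma outer_component [simp]: "outer v $ i $ k = v $ i * v $ k"
  by (simp add: outer_def)

lemma inner_outer: "S \<bullet> outer v = v \<bullet> (S *v v)"
  by (simp add: outer_def inner_vec_def matrix_vector_mult_def sum_distrib_left mult_ac)

lemma transpose_outer: "transpose (outer v) = outer v"
  by (simp add: outer_def transpose_def vec_eq_iff mult.commute)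

lemma subspace_symmetric_matrices: "subspace {M :: real^'n^'n. transpose M = M}"
  unfolding subspace_def by (auto simp: transpose_def vec_eq_iff)

lemma symmetric_in_span_outer_if_extreme_gram:
  fixes A M :: "real^'n^'n" and w :: "'k::finite \<Rightarrow> real^'n"
  assumes ext: "gram A w extreme_point_of elliptope"
    and A_sym: "transpose A = A"
    and pd: "\<And>x. x \<noteq> 0 \<Longrightarrow> 0 < x \<bullet> (A *v x)"
    and basis: "\<And>i. axis i 1 \<in> range w"
    and M_sym: "transpose M = M"
  shows "M \<in> span (outer ` range w)"
proof (rule ccontr)
  let ?O = "outer ` range w"
  assume "M \<notin> span ?O"
  moreover have "span ?O \<subseteq> span (insert M ?O)" "M \<in> span (insert M ?O)"
    by (simp_all add: span_mono subset_insertI span_base)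
  ultimately have "span ?O \<subset> span (insert M ?O)"
    by blast
  then obtain S where S: "S \<noteq> 0" "S \<in> span (insert M ?O)" "\<And>y. y \<in> span ?O \<Longrightarrow> orthogonal S y"
    using orthogonal_to_subspace_exists_gen by blast
  have "insert M ?O \<subseteq> {M. transpose M = M}"
    using M_sym transpose_outer by auto
  then have S_sym: "transpose S = S"
    using S(2) span_minimal[OF _ subspace_symmetric_matrices] by blast
  have "w p \<bullet> (S *v w p) = 0" for p
    using S(3)[of "outer (w p)"] by (simp add: span_base orthogonal_def inner_outer)
  then have "gram S w = 0"
    using extreme_gram_trivial_perturbation[OF ext A_sym S_sym pd] by blast
  moreover have "S $ i $ k = gram S w $ p $ q" if "w p = axis i 1" "w q = axis k 1" for i k p q
    using that by (simp add: gram_def inner_axis' matrix_vector_mult_basis column_def)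
  ultimately have "S $ i $ k = 0" for i k
    using basis by (metis rangeE zero_index)
  then show False
    using S(1) by (simp add: vec_eq_iff)
qed

section \<open>Linear combinations of matrices\<close>

lemma matrix_add_rdistrib: "((A :: 'a::semiring_1^'n^'m) + B) ** C = A ** C + B ** C"
  by (vector matrix_matrix_mult_def sum.distrib[symmetric] field_simps)

lemma matrix_mul_sum_left: "(\<Sum>i\<in>I. f i) ** (M :: 'a::semiring_1^'n^'n) = (\<Sum>i\<in>I. f i ** M)"
  by (induction I rule: infinite_finite_induct) (auto simp: matrix_add_rdistrib)

lemma matrix_mul_sum_right: "(M :: 'a::semiring_1^'n^'n) ** (\<Sum>i\<in>I. f i) = (\<Sum>i\<in>I. M ** f i)"
  by (induction I rule: infinite_finite_induct) (auto simp: matrix_add_ldistrib)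

definition matrix_comb :: "('n::finite \<Rightarrow> complex^'d^'d) \<Rightarrow> real^'n \<Rightarrow> complex^'d^'d" where
  "matrix_comb X \<mu> = (\<Sum>i\<in>UNIV. \<mu> $ i *\<^sub>R X i)"

lemma matrix_comb_add: "matrix_comb X (a + b) = matrix_comb X a + matrix_comb X b"
  by (simp add: matrix_comb_def scaleR_add_left sum.distrib)

lemma matrix_comb_axis: "matrix_comb X (axis i 1) = X i"
  by (simp add: matrix_comb_def axis_def if_distrib[of "\<lambda>c. c *\<^sub>R _"] sum.delta' cong: if_cong)

lemma matrix_comb_column: "matrix_comb X (column j \<Lambda>) = (\<Sum>i\<in>UNIV. \<Lambda> $ i $ j *\<^sub>R X i)"
  by (simp add: matrix_comb_def column_def)

lemma matrix_comb_square:
  "matrix_comb X \<mu> ** matrix_comb X \<mu> = (\<Sum>i\<in>UNIV. \<Sum>k\<in>UNIV. (\<mu> $ i * \<mu> $ k) *\<^sub>R (X i ** X k))"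
proof -
  have "matrix_comb X \<mu> ** matrix_comb X \<mu> = (\<Sum>k\<in>UNIV. \<Sum>i\<in>UNIV. (\<mu> $ i * \<mu> $ k) *\<^sub>R (X i ** X k))"
    by (simp add: matrix_comb_def matrix_mul_sum_left matrix_mul_sum_right scaleR_sum_right
        matrix_scalar_ac scalar_matrix_assoc[symmetric] mult.commute)
  also have "\<dots> = (\<Sum>i\<in>UNIV. \<Sum>k\<in>UNIV. (\<mu> $ i * \<mu> $ k) *\<^sub>R (X i ** X k))"
    by (rule sum.swap)
  finally show ?thesis .
qed

lemma square_identity_on_span_outer:
  fixes X :: "'n::finite \<Rightarrow> complex^'d^'d" and A :: "real^'n^'n"
  assumes "\<And>v. v \<in> W \<Longrightarrow> matrix_comb X v ** matrix_comb X v = (v \<bullet> (A *v v)) *\<^sub>R mat 1"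
    and "outer \<mu> \<in> span (outer ` W)"
  shows "matrix_comb X \<mu> ** matrix_comb X \<mu> = (\<mu> \<bullet> (A *v \<mu>)) *\<^sub>R mat 1"
proof -
  define D where
    "D M = (\<Sum>i\<in>UNIV. \<Sum>k\<in>UNIV. M $ i $ k *\<^sub>R (X i ** X k)) - (A \<bullet> M) *\<^sub>R (mat 1 :: complex^'d^'d)"
    for M :: "real^'n^'n"
  have "linear D"
    by (rule linearI)
      (simp_all add: D_def scaleR_add_left sum.distrib inner_add_right scaleR_sum_right scaleR_diff_right
        algebra_simps)
  have D_outer: "D (outer v) = matrix_comb X v ** matrix_comb X v - (v \<bullet> (A *v v)) *\<^sub>R mat 1" for v
    by (simp add: D_def matrix_comb_square inner_outer)
  have "D M = 0" if "M \<in> outer ` W" for M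
    using that D_outer assms(1) by auto
  then have "D (outer \<mu>) = 0"
    using linear_eq_0_on_span[OF \<open>linear D\<close>] assms(2) by blast
  then show ?thesis
    by (simp add: D_outer)
qed

lemma extreme_gram_square_identity:
  fixes A :: "real^'n^'n" and w :: "'k::finite \<Rightarrow> real^'n" and X :: "'n \<Rightarrow> complex^'d^'d"
  assumes ext: "gram A w extreme_point_of elliptope"
    and A_sym: "transpose A = A"
    and pd: "\<And>x. x \<noteq> 0 \<Longrightarrow> 0 < x \<bullet> (A *v x)"
    and basis: "\<And>i. axis i 1 \<in> range w"
    and generators: "\<And>p. matrix_comb X (w p) ** matrix_comb X (w p) = (w p \<bullet> (A *v w p)) *\<^sub>R mat 1"
  shows "matrix_comb X \<mu> ** matrix_comb X \<mu> = (\<mu> \<bullet> (A *v \<mu>)) *\<^sub>R mat 1"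
proof (rule square_identity_on_span_outer)
  show "outer \<mu> \<in> span (outer ` range w)"
    by (rule symmetric_in_span_outer_if_extreme_gram[OF ext A_sym pd basis transpose_outer])
qed (use generators in auto)

lemma matrix_comb_anticommutator:
  fixes X :: "'n::finite \<Rightarrow> complex^'d^'d" and A :: "real^'n^'n"
  assumes A_sym: "transpose A = A"
    and square: "\<And>\<mu>. matrix_comb X \<mu> ** matrix_comb X \<mu> = (\<mu> \<bullet> (A *v \<mu>)) *\<^sub>R mat 1"
  shows "matrix_comb X a ** matrix_comb X b + matrix_comb X b ** matrix_comb X a
    = (2 * (a \<bullet> (A *v b))) *\<^sub>R mat 1"
proof -
  let ?Y = "matrix_comb X"
  have "?Y (a + b) ** ?Y (a + b) = ?Y a ** ?Y a + ?Y b ** ?Y b + (?Y a ** ?Y b + ?Y b ** ?Y a)"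
    by (simp add: matrix_comb_add matrix_add_ldistrib matrix_add_rdistrib algebra_simps)
  moreover have "(a + b) \<bullet> (A *v (a + b)) = a \<bullet> (A *v a) + b \<bullet> (A *v b) + 2 * (a \<bullet> (A *v b))"
    using symmetric_bilinear_form[OF A_sym, of b a]
    by (simp add: matrix_vector_right_distrib inner_add_left inner_add_right)
  ultimately show ?thesis
    using square[of "a + b"] square[of a] square[of b] by (simp add: scaleR_add_left)
qed

section \<open>Anticommuting involutions\<close>

lemma involution_apply: "(A :: 'a::semiring_1^'n^'n) ** A = mat 1 \<Longrightarrow> A *v (A *v v) = v"
  by (simp add: matrix_vector_mul_assoc)

lemma anticommuting_apply:
  fixes A B :: "'a::ring_1^'n^'n"
  assumes "A ** B + B ** A = 0"
  shows "A *v (B *v v) = - (B *v (A *v v))"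
proof -
  have "(A ** B + B ** A) *v v = 0"
    using assms by simp
  then show ?thesis
    by (simp add: matrix_vector_mult_add_rdistrib matrix_vector_mul_assoc eq_neg_iff_add_eq_0)
qed

lemma matrix_vector_mult_scaleR_algebra:
  "(A :: 'a::real_algebra_1^'n^'m) *v (r *\<^sub>R x) = r *\<^sub>R (A *v x)"
  by (simp add: matrix_vector_mult_def vec_eq_iff scaleR_sum_right)

(* dim is the real dimension, so dim (UNIV :: (complex^'d) set) = 2 * CARD('d). *)
definition complex_subspace :: "(complex^'d) set \<Rightarrow> bool" where
  "complex_subspace V \<longleftrightarrow> subspace V \<and> (\<forall>v\<in>V. \<i> *s v \<in> V)"

lemma complex_subspace_dim_ge_2:
  assumes "complex_subspace V" and "v \<in> V" and "v \<noteq> 0"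
  shows "2 \<le> dim V"
proof -
  have "\<i> *s v \<notin> span {v}"
  proof
    assume "\<i> *s v \<in> span {v}"
    then obtain r where r: "\<i> *s v = r *\<^sub>R v"
      by (auto simp: span_singleton)
    obtain i where "v $ i \<noteq> 0"
      using \<open>v \<noteq> 0\<close> by (metis vec_eq_iff zero_index)
    moreover have "\<i> * v $ i = r *\<^sub>R v $ i"
      using arg_cong[OF r, of "\<lambda>u. u $ i"] by (simp only: vector_smult_component vector_scaleR_component)
    ultimately have "\<i> = of_real r"
      by (simp add: scaleR_conv_of_real)
    then show False
      by (simp add: complex_eq_iff)
  qed
  then have "dim {\<i> *s v, v} = 2"
    using \<open>v \<noteq> 0\<close> by (simp add: dim_insert)
  moreover have "dim {\<i> *s v, v} \<le> dim V"
    using assms unfolding complex_subspace_def by (intro dim_subset) auto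
  ultimately show ?thesis
    by simp
qed

definition pair_eigenspace ::
    "complex^'d^'d \<Rightarrow> complex^'d^'d \<Rightarrow> (complex^'d) set \<Rightarrow> complex \<Rightarrow> (complex^'d) set" where
  "pair_eigenspace X1 X2 V c = {v \<in> V. X1 *v (X2 *v v) = c *s v}"

lemma complex_subspace_pair_eigenspace:
  assumes "complex_subspace V"
  shows "complex_subspace (pair_eigenspace X1 X2 V c)"
  using assms
  unfolding complex_subspace_def subspace_def pair_eigenspace_def
  by (auto simp: vec.add vector_scalar_commute matrix_vector_mult_scaleR_algebra vec_eq_iff
      algebra_simps)

lemma pair_eigenspace_invariant:
  assumes "\<And>u. X1 *v (Z *v u) = - (Z *v (X1 *v u))" and "\<And>u. X2 *v (Z *v u) = - (Z *v (X2 *v u))"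
    and "Z *v v \<in> V" and "v \<in> pair_eigenspace X1 X2 V c"
  shows "Z *v v \<in> pair_eigenspace X1 X2 V c"
  using assms by (simp add: pair_eigenspace_def vec.neg vector_scalar_commute)

lemma pair_eigenspace_swap:
  assumes X1_X1: "\<And>u. X1 *v (X1 *v u) = u" and X1_X2: "\<And>u. X2 *v (X1 *v u) = - (X1 *v (X2 *v u))"
    and "X1 *v v \<in> V" and v: "v \<in> pair_eigenspace X1 X2 V c"
  shows "X1 *v v \<in> pair_eigenspace X1 X2 V (- c)"
proof -
  have "X2 *v v = c *s (X1 *v v)"
    using X1_X1[of "X2 *v v"] v by (simp add: pair_eigenspace_def vector_scalar_commute)
  then have "X1 *v (X2 *v (X1 *v v)) = - c *s (X1 *v v)"
    by (simp add: X1_X2 X1_X1 vec.neg vector_scalar_commute vector_smult_lneg)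
  then show ?thesis
    using \<open>X1 *v v \<in> V\<close> by (simp add: pair_eigenspace_def)
qed

lemma pair_eigenspace_dim:
  assumes X1_X1: "\<And>u. X1 *v (X1 *v u) = u" and X1_X2: "\<And>u. X2 *v (X1 *v u) = - (X1 *v (X2 *v u))"
    and V: "complex_subspace V" "\<And>v. v \<in> V \<Longrightarrow> X1 *v v \<in> V"
  shows "2 * dim (pair_eigenspace X1 X2 V (- \<i>)) \<le> dim V"
proof -
  let ?P = "pair_eigenspace X1 X2 V (- \<i>)" and ?M = "pair_eigenspace X1 X2 V \<i>"
  have subspaces: "subspace ?P" "subspace ?M"
    using complex_subspace_pair_eigenspace[OF V(1)] by (simp_all add: complex_subspace_def)
  have "?P = (*v) X1 ` ((*v) X1 ` ?P)"
    by (simp add: image_image X1_X1)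
  also have "dim \<dots> \<le> dim ((*v) X1 ` ?P)"
    by (rule dim_image_le) simp
  also have "\<dots> \<le> dim ?M"
  proof (intro dim_subset image_subsetI)
    fix v assume "v \<in> ?P"
    then have "X1 *v v \<in> V"
      using V(2) by (simp add: pair_eigenspace_def)
    then show "X1 *v v \<in> ?M"
      using pair_eigenspace_swap[OF X1_X1 X1_X2 _ \<open>v \<in> ?P\<close>] by simp
  qed
  finally have "dim ?P \<le> dim ?M" .
  moreover have "?P \<inter> ?M \<subseteq> {0}"
    by (auto simp: pair_eigenspace_def vec_eq_iff)
  then have "dim ?P + dim ?M = dim {x + y |x y. x \<in> ?P \<and> y \<in> ?M}"
    using dim_sums_Int[OF subspaces] dim_eq_0[of "?P \<inter> ?M"] by linarith
  moreover have "dim {x + y |x y. x \<in> ?P \<and> y \<in> ?M} \<le> dim V"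
    using V(1) unfolding complex_subspace_def
    by (intro dim_subset) (auto simp: pair_eigenspace_def subspace_add)
  ultimately show ?thesis
    by linarith
qed

lemma pair_eigenspace_nonzero:
  assumes X1_X1: "\<And>u. X1 *v (X1 *v u) = u" and X2_X2: "\<And>u. X2 *v (X2 *v u) = u"
    and X1_X2: "\<And>u. X2 *v (X1 *v u) = - (X1 *v (X2 *v u))"
    and V: "complex_subspace V" "\<And>v. v \<in> V \<Longrightarrow> X1 *v v \<in> V" "\<And>v. v \<in> V \<Longrightarrow> X2 *v v \<in> V"
    and "v \<in> V" and "v \<noteq> 0"
  obtains u where "u \<in> pair_eigenspace X1 X2 V (- \<i>)" and "u \<noteq> 0"
proof -
  let ?J = "\<lambda>u. X1 *v (X2 *v u)"
  have J_J: "?J (?J u) = - u" for u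
    by (simp add: X1_X2 X1_X1 X2_X2 vec.neg)
  define p where "p = v + \<i> *s ?J v"
  define m where "m = v - \<i> *s ?J v"
  have "p \<in> V" "m \<in> V"
    using V \<open>v \<in> V\<close> unfolding complex_subspace_def p_def m_def by (auto simp: subspace_add subspace_diff)
  then have p: "p \<in> pair_eigenspace X1 X2 V (- \<i>)" and m: "m \<in> pair_eigenspace X1 X2 V \<i>"
    unfolding pair_eigenspace_def p_def m_def
    by (auto simp: vec.add vec.diff vector_scalar_commute J_J vec_eq_iff algebra_simps)
  have "p + m = 2 *s v"
    by (simp add: p_def m_def vec_eq_iff)
  then consider "p \<noteq> 0" | "m \<noteq> 0"
    using \<open>v \<noteq> 0\<close> by (force simp: vec_eq_iff)
  then show ?thesis
  proof cases
    case 1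
    with p that show ?thesis by blast
  next
    case 2
    have "X1 *v m \<in> pair_eigenspace X1 X2 V (- \<i>)"
      using pair_eigenspace_swap[OF X1_X1 X1_X2 _ m] V(2) m by (simp add: pair_eigenspace_def)
    moreover have "X1 *v m \<noteq> 0"
      using 2 X1_X1[of m] by auto
    ultimately show ?thesis
      using that by blast
  qed
qed

definition anticommuting_involutions :: "nat \<Rightarrow> (nat \<Rightarrow> complex^'d^'d) \<Rightarrow> bool" where
  "anticommuting_involutions k Z \<longleftrightarrow>
     (\<forall>i<k. Z i ** Z i = mat 1) \<and> (\<forall>i<k. \<forall>j<k. i \<noteq> j \<longrightarrow> Z i ** Z j + Z j ** Z i = 0)"

lemma anticommuting_involutions_dim:
  assumes "anticommuting_involutions k Z" and "complex_subspace V"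
    and "\<And>i v. i < k \<Longrightarrow> v \<in> V \<Longrightarrow> Z i *v v \<in> V" and "v \<in> V" and "v \<noteq> 0"
  shows "2 * 2 ^ (k div 2) \<le> dim V"
  using assms
proof (induction k arbitrary: V v rule: nat_induct2)
  case 0
  then show ?case
    using complex_subspace_dim_ge_2 by simp
next
  case 1
  then show ?case
    using complex_subspace_dim_ge_2 by simp
next
  case (step n)
  let ?X1 = "Z n" and ?X2 = "Z (Suc n)"
  let ?E = "pair_eigenspace ?X1 ?X2 V (- \<i>)"
  have inv: "Z i ** Z i = mat 1" if "i < n + 2" for i
    using step.prems(1) that by (simp add: anticommuting_involutions_def)
  have anti: "Z i ** Z j + Z j ** Z i = 0" if "i < n + 2" "j < n + 2" "i \<noteq> j" for i j
    using step.prems(1) that by (simp add: anticommuting_involutions_def)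
  have X1_X1: "?X1 *v (?X1 *v u) = u" and X2_X2: "?X2 *v (?X2 *v u) = u" for u
    by (simp_all add: involution_apply inv)
  have X1_X2: "?X2 *v (?X1 *v u) = - (?X1 *v (?X2 *v u))" for u
    by (rule anticommuting_apply) (simp add: anti)
  have V: "?X1 *v v \<in> V" "?X2 *v v \<in> V" if "v \<in> V" for v
    using step.prems(3) that by simp_all
  have E: "complex_subspace ?E"
    by (rule complex_subspace_pair_eigenspace[OF step.prems(2)])
  obtain u where u: "u \<in> ?E" "u \<noteq> 0"
    using pair_eigenspace_nonzero[OF X1_X1 X2_X2 X1_X2 step.prems(2) V step.prems(4,5)] by blast
  have E_invariant: "Z i *v w \<in> ?E" if "i < n" "w \<in> ?E" for i w
  proof (rule pair_eigenspace_invariant[OF _ _ _ \<open>w \<in> ?E\<close>])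
    show "?X1 *v (Z i *v x) = - (Z i *v (?X1 *v x))" for x
      using \<open>i < n\<close> by (intro anticommuting_apply) (simp add: anti)
    show "?X2 *v (Z i *v x) = - (Z i *v (?X2 *v x))" for x
      using \<open>i < n\<close> by (intro anticommuting_apply) (simp add: anti)
    show "Z i *v w \<in> V"
      using step.prems(3) that by (simp add: pair_eigenspace_def)
  qed
  have "anticommuting_involutions n Z"
    using step.prems(1) by (simp add: anticommuting_involutions_def)
  then have "2 * 2 ^ (n div 2) \<le> dim ?E"
    by (rule step.IH[OF _ E E_invariant u])
  moreover have "2 * dim ?E \<le> dim V"
    by (rule pair_eigenspace_dim[OF X1_X1 X1_X2 step.prems(2) V(1)])
  ultimately show ?case
    by simp
qed

lemma square_identity_dim_bound:
  fixes X :: "'n::finite \<Rightarrow> complex^'d::finite^'d" and A :: "real^'n^'n"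
  assumes A_sym: "transpose A = A" and pd: "\<And>x. x \<noteq> 0 \<Longrightarrow> 0 < x \<bullet> (A *v x)"
    and square: "\<And>\<mu>. matrix_comb X \<mu> ** matrix_comb X \<mu> = (\<mu> \<bullet> (A *v \<mu>)) *\<^sub>R mat 1"
  shows "2 ^ (CARD('n) div 2) \<le> CARD('d)"
proof -
  obtain e where e: "\<forall>i<CARD('n). \<forall>j<CARD('n). e i \<bullet> (A *v e j) = (if i = j then 1 else 0)"
    using pos_def_orthonormal_family[OF A_sym pd subspace_UNIV, of "CARD('n)"] by auto
  have "anticommuting_involutions CARD('n) (\<lambda>i. matrix_comb X (e i))"
    using e square matrix_comb_anticommutator[OF A_sym square]
    by (simp add: anticommuting_involutions_def)
  moreover have "complex_subspace (UNIV :: (complex^'d) set)"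
    by (simp add: complex_subspace_def)
  moreover obtain i :: 'd where True by blast
  then have "(axis i 1 :: complex^'d) \<noteq> 0"
    by (simp add: axis_eq_0_iff)
  ultimately have "2 * 2 ^ (CARD('n) div 2) \<le> dim (UNIV :: (complex^'d) set)"
    using anticommuting_involutions_dim by blast
  then show ?thesis
    by simp
qed

section \<open>Block matrices\<close>

lemma blkA_eq_gram: "blkA E = gram E (\<lambda>i. axis (Inl i) 1)"
  by (simp add: blkA_def gram_def vec_eq_iff inner_axis' matrix_vector_mult_basis column_def)

lemma block_matrix_eq_gram:
  fixes E :: "real^('n::finite + 'm::finite)^('n + 'm)" and \<Lambda> :: "real^'m^'n"
  assumes E_sym: "transpose E = E"
    and hC: "blkC E = blkA E ** \<Lambda>"
    and hB: "blkB E = transpose \<Lambda> ** blkA E ** \<Lambda>"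
  shows "E = gram (blkA E) (case_sum (\<lambda>i. axis i 1) (\<lambda>j. column j \<Lambda>))"
proof -
  let ?A = "blkA E" and ?w = "case_sum (\<lambda>i. axis i 1) (\<lambda>j. column j \<Lambda>) :: 'n + 'm \<Rightarrow> real^'n"
  have sym: "E $ q $ p = E $ p $ q" for p q
  proof -
    have "E $ q $ p = transpose E $ p $ q"
      by (simp add: transpose_def)
    then show ?thesis
      using E_sym by simp
  qed
  have A_sym: "transpose ?A = ?A"
    using sym by (simp add: blkA_def transpose_def vec_eq_iff)
  have C: "E $ Inl i $ Inr j = (?A *v column j \<Lambda>) $ i" for i j
  proof -
    have "E $ Inl i $ Inr j = (?A ** \<Lambda>) $ i $ j"
      using arg_cong[OF hC, of "\<lambda>M. M $ i $ j"] by (simp add: blkC_def)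
    then show ?thesis
      by (simp add: matrix_matrix_mult_def matrix_vector_mult_def column_def)
  qed
  have B: "E $ Inr j $ Inr l = column j \<Lambda> \<bullet> (?A *v column l \<Lambda>)" for j l
  proof -
    have "E $ Inr j $ Inr l = (transpose \<Lambda> ** ?A ** \<Lambda>) $ j $ l"
      using arg_cong[OF hB, of "\<lambda>M. M $ j $ l"] by (simp add: blkB_def)
    also have "\<dots> = (\<Sum>k\<in>UNIV. \<Sum>i\<in>UNIV. \<Lambda> $ i $ j * ?A $ i $ k * \<Lambda> $ k $ l)"
      by (simp add: matrix_matrix_mult_def transpose_def sum_distrib_right)
    also have "\<dots> = (\<Sum>i\<in>UNIV. \<Sum>k\<in>UNIV. \<Lambda> $ i $ j * ?A $ i $ k * \<Lambda> $ k $ l)"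
      by (rule sum.swap)
    also have "\<dots> = column j \<Lambda> \<bullet> (?A *v column l \<Lambda>)"
      by (simp add: matrix_vector_mult_def column_def inner_vec_def sum_distrib_left mult.assoc)
    finally show ?thesis .
  qed
  have "E $ p $ q = ?w p \<bullet> (?A *v ?w q)" for p q
  proof (cases p; cases q)
    fix i k assume "p = Inl i" "q = Inl k"
    then show ?thesis
      by (simp add: inner_axis' matrix_vector_mult_basis column_def blkA_def)
  next
    fix i j assume "p = Inl i" "q = Inr j"
    then show ?thesis
      by (simp add: inner_axis' C)
  next
    fix j i assume "p = Inr j" "q = Inl i"
    then show ?thesis
      using symmetric_bilinear_form[OF A_sym, of "axis i 1" "column j \<Lambda>"] sym
      by (simp add: inner_axis' C)
  next
    fix j l assume "p = Inr j" "q = Inr l"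
    then show ?thesis
      by (simp add: B)
  qed
  then show ?thesis
    by (simp add: gram_def vec_eq_iff)
qed

theorem lemma2p7:
  fixes E :: "real^('n::finite + 'm::finite)^('n + 'm)"
    and \<Lambda> :: "real^'m^'n"
    and X :: "'n \<Rightarrow> complex^'d::finite^'d"
  assumes ext: "E extreme_point_of elliptope"
    and rankA: "rank (blkA E) = CARD('n)"
    and rankE: "rank E = CARD('n)"
    and hC: "blkC E = blkA E ** \<Lambda>"
    and hB: "blkB E = transpose \<Lambda> ** blkA E ** \<Lambda>"
    and herm: "\<And>i. hermitian_cmat (X i)"
    and sq: "\<And>i. X i ** X i = mat 1"
    and sqL: "\<And>j. (\<Sum>i\<in>UNIV. \<Lambda> $ i $ j *\<^sub>R X i) ** (\<Sum>i\<in>UNIV. \<Lambda> $ i $ j *\<^sub>R X i) = mat 1"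
  shows "(\<forall>\<mu> :: real^'n.
           (\<Sum>i\<in>UNIV. \<mu> $ i *\<^sub>R X i) ** (\<Sum>i\<in>UNIV. \<mu> $ i *\<^sub>R X i)
             = (\<mu> \<bullet> (blkA E *v \<mu>)) *\<^sub>R mat 1)
         \<and> CARD('d) \<ge> 2 ^ (CARD('n) div 2)"
proof -
  define A where "A = blkA E"
  let ?w = "case_sum (\<lambda>i. axis i 1) (\<lambda>j. column j \<Lambda>) :: 'n + 'm \<Rightarrow> real^'n"
  have E: "psd_mat E" "\<And>p. E $ p $ p = 1"
    using ext by (simp_all add: extreme_point_of_def elliptope_def)
  have E_gram: "E = gram A ?w"
    using E(1) hC hB unfolding psd_mat_def A_def by (intro block_matrix_eq_gram) simp_all
  have "psd_mat A"
    using E(1) unfolding A_def blkA_eq_gram by (intro psd_mat_gram) (simp_all add: psd_mat_def)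
  then have A_sym: "transpose A = A" and pd: "\<And>x. x \<noteq> 0 \<Longrightarrow> 0 < x \<bullet> (A *v x)"
    using psd_full_rank_imp_pos_def rankA by (simp_all add: psd_mat_def A_def)
  have "?w p \<bullet> (A *v ?w p) = 1" for p
    using E(2)[of p] unfolding E_gram by (simp add: gram_def)
  moreover have "matrix_comb X (?w p) ** matrix_comb X (?w p) = mat 1" for p
    by (cases p) (simp_all add: matrix_comb_axis matrix_comb_column sq sqL)
  ultimately have generators:
    "matrix_comb X (?w p) ** matrix_comb X (?w p) = (?w p \<bullet> (A *v ?w p)) *\<^sub>R mat 1" for p
    by simp
  have "matrix_comb X \<mu> ** matrix_comb X \<mu> = (\<mu> \<bullet> (A *v \<mu>)) *\<^sub>R mat 1" for \<mu>
  proof (rule extreme_gram_square_identity[OF _ A_sym pd _ generators])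
    show "gram A ?w extreme_point_of elliptope"
      using ext unfolding E_gram .
    show "axis i 1 \<in> range ?w" for i
      by (rule range_eqI[of _ _ "Inl i"]) simp
  qed
  then show ?thesis
    using square_identity_dim_bound[OF A_sym pd] unfolding matrix_comb_def A_def by blast
qed

end
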